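(* Let $n\ge 1$ and $m\geq 0$ be integers such that $m<n-1$. Then $$\sum_{k=0}^{n} \binom{n+k}{2k} \binom{2k}{k} \frac{(-1)^k}{(n+k)(m+k+1)^2} = \frac{(-1)^m (m!)^2 (n-m-2)!}{(n+m+1)!}.$$ *)

theory Defs
  imports Complex_Main
begin

end

theory Submission
  imports Defs
begin

text \<open>
  Writing the binomials as factorials, the \<open>k\<close>-th coefficient of the sum is
  \<open>(-1)^k * (n choose k) * Q k / n!\<close> with \<open>Q t = (t + 1) * ... * (t + n - 1)\<close>. Because
  \<open>1 \<le> m + 1 \<le> n - 1\<close>, the number \<open>t + m + 1\<close> is one of the factors of \<open>Q t\<close>, so it cancels one
  of the two factors \<open>m + k + 1\<close> in the denominator. What remains is
  \<open>(1 / n!) * (\<Sum>k\<le>n. (-1)^k * (n choose k) * R k / (x + k))\<close> at \<open>x = m + 1\<close>, where the polynomial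
  \<open>R t = Q t / (t + m + 1)\<close> has degree \<open>n - 2\<close>.

  For any polynomial \<open>R\<close> of degree at most \<open>n\<close> this sum is the partial fraction expansion of
  \<open>n! * R (-x) / (x * (x + 1) * ... * (x + n))\<close>
  (lemma \<open>alternating_binomial_partial_fractions\<close>, for \<open>R\<close> a product of linear factors).
  It therefore only remains to evaluate \<open>R (-m - 1)\<close>, the product of the nonzero differences
  \<open>j - (m + 1)\<close> for \<open>1 \<le> j < n\<close>, which is \<open>(-1)^m * m! * (n - m - 2)!\<close>.
\<close>

text \<open>
  An \<open>n\<close>-th finite difference annihilates polynomials of degree below \<open>n\<close>; the polynomial is given
  here by its linear factors. One factor is removed at a time: in \<open>(k + c) * (n choose k)\<close> the part
  \<open>k * (n choose k) = n * (n - 1 choose k - 1)\<close> lowers \<open>n\<close> and shifts the remaining factors by \<open>1\<close>,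
  which is why the offsets \<open>c\<close> vary in the induction.
\<close>

lemma alternating_binomial_sum_prod_eq_0:
  fixes c :: "'i \<Rightarrow> 'a::comm_ring_1"
  assumes "finite J" and "card J < n"
  shows "(\<Sum>k\<le>n. (-1) ^ k * of_nat (n choose k) * (\<Prod>j\<in>J. of_nat k + c j)) = 0"
  using assms
proof (induction J arbitrary: n c rule: finite_induct)
  case empty
  then show ?case
    using choose_alternating_sum[of n, where 'a='a] by simp
next
  case (insert i J)
  then obtain p where n: "n = Suc p" and p: "card J < p"
    by (cases n) auto
  let ?P = "\<lambda>k. \<Prod>j\<in>J. of_nat k + c j"
  let ?a = "\<lambda>k. (-1) ^ k * of_nat (n choose k) :: 'a"
  have absorb: "of_nat (Suc k) * of_nat (n choose Suc k) = (of_nat n * of_nat (p choose k) :: 'a)" for k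
    unfolding n of_nat_mult[symmetric] using binomial_absorption[of k "Suc p"] by (simp only: diff_Suc_1)
  have "(\<Sum>k\<le>n. ?a k * (of_nat k * ?P k))
      = (\<Sum>k\<le>p. ?a (Suc k) * (of_nat (Suc k) * ?P (Suc k)))"
    unfolding n by (subst sum.atMost_Suc_shift) simp
  also have "\<dots> = (\<Sum>k\<le>p. - of_nat n * ((-1) ^ k * of_nat (p choose k) * ?P (Suc k)))"
  proof (rule sum.cong)
    fix k
    have "?a (Suc k) * (of_nat (Suc k) * ?P (Suc k))
        = - ((-1) ^ k * (of_nat (Suc k) * of_nat (n choose Suc k)) * ?P (Suc k))"
      by (simp only: power_Suc mult_ac mult_minus_left mult_minus_right mult_1)
    then show "?a (Suc k) * (of_nat (Suc k) * ?P (Suc k))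
        = - of_nat n * ((-1) ^ k * of_nat (p choose k) * ?P (Suc k))"
      unfolding absorb by (simp only: mult_ac mult_minus_left mult_minus_right)
  qed simp
  also have "\<dots> = - of_nat n * (\<Sum>k\<le>p. (-1) ^ k * of_nat (p choose k) * (\<Prod>j\<in>J. of_nat k + (1 + c j)))"
    by (simp add: sum_distrib_left add_ac)
  also have "\<dots> = 0"
    using insert.IH[OF p, of "\<lambda>j. 1 + c j"] by simp
  finally have shifted: "(\<Sum>k\<le>n. ?a k * (of_nat k * ?P k)) = 0" .
  have "(\<Sum>k\<le>n. ?a k * (\<Prod>j\<in>insert i J. of_nat k + c j))
      = (\<Sum>k\<le>n. ?a k * (of_nat k * ?P k)) + c i * (\<Sum>k\<le>n. ?a k * ?P k)"
    using insert.hyps by (simp add: sum_distrib_left flip: sum.distrib) (simp add: algebra_simps)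
  also have "\<dots> = 0"
    using shifted insert.IH[of n c] n p by simp
  finally show ?case .
qed

text \<open>
  Pascal's rule shows that the left-hand side \<open>S n x\<close> satisfies \<open>S (n + 1) x = S n x - S n (x + 1)\<close>,
  and the quotients on the right satisfy the same recurrence.
\<close>

lemma alternating_binomial_reciprocals:
  fixes x :: "'a::field_char_0"
  assumes "\<And>k. k \<le> n \<Longrightarrow> x + of_nat k \<noteq> 0"
  shows "(\<Sum>k\<le>n. (-1) ^ k * of_nat (n choose k) / (x + of_nat k)) = fact n / pochhammer x (Suc n)"
  using assms
proof (induction n arbitrary: x)
  case 0
  then show ?case by simp
next
  case (Suc n)
  let ?S = "\<lambda>n x. \<Sum>k\<le>n. (-1) ^ k * of_nat (n choose k) / (x + of_nat k) :: 'a"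
  have nz: "x \<noteq> 0" "x + 1 + of_nat n \<noteq> 0"
    using Suc.prems[of 0] Suc.prems[of "Suc n"] by (auto simp: add_ac)
  have nzp: "pochhammer (x + 1) n \<noteq> 0"
  proof
    assume "pochhammer (x + 1) n = 0"
    then obtain k where "k < n" "x + 1 = - of_nat k"
      by (auto simp: pochhammer_eq_0_iff)
    then show False
      using Suc.prems[of "Suc k"] by (simp add: eq_neg_iff_add_eq_0 add_ac)
  qed
  have left: "?S n x = fact n / pochhammer x (Suc n)"
    using Suc.prems by (intro Suc.IH) simp
  have right: "?S n (x + 1) = fact n / pochhammer (x + 1) (Suc n)"
  proof (rule Suc.IH)
    fix k assume "k \<le> n"
    then show "x + 1 + of_nat k \<noteq> 0"
      using Suc.prems[of "Suc k"] by (simp add: add_ac)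
  qed
  have extend: "?S n x = (\<Sum>k\<le>Suc n. (-1) ^ k * of_nat (n choose k) / (x + of_nat k))"
    by simp
  have "?S (Suc n) x = ?S n x - ?S n (x + 1)"
    unfolding extend
    by (subst (1 2) sum.atMost_Suc_shift)
       (simp add: sum_subtractf sum.distrib sum_negf add_divide_distrib diff_divide_distrib
          algebra_simps del: sum.atMost_Suc)
  also have "\<dots> = fact n / (x * pochhammer (x + 1) n)
      - fact n / ((x + 1 + of_nat n) * pochhammer (x + 1) n)"
    unfolding left right pochhammer_rec[of x n] pochhammer_rec'[of "x + 1" n] by simp
  also have "\<dots> = of_nat (Suc n) * fact n / (x * ((x + 1 + of_nat n) * pochhammer (x + 1) n))"
    using nz nzp by (simp add: divide_simps) (simp add: algebra_simps)
  also have "\<dots> = fact (Suc n) / pochhammer x (Suc (Suc n))"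
    unfolding pochhammer_rec[of x "Suc n"] pochhammer_rec'[of "x + 1" n] by simp
  finally show ?case .
qed

text \<open>
  The partial fraction expansion over the poles \<open>0, -1, ..., -n\<close>. Each linear factor of the numerator
  is split off by \<open>(k + c) / (x + k) = 1 + (c - x) / (x + k)\<close>: the \<open>1\<close> contributes a vanishing
  finite difference, and the other part contributes the value \<open>c - x\<close> of the factor at \<open>-x\<close>.
\<close>

lemma alternating_binomial_partial_fractions:
  fixes x :: "'a::field_char_0" and c :: "'i \<Rightarrow> 'a"
  assumes "finite J" and "card J \<le> n" and x: "\<And>k. k \<le> n \<Longrightarrow> x + of_nat k \<noteq> 0"
  shows "(\<Sum>k\<le>n. (-1) ^ k * of_nat (n choose k) * (\<Prod>j\<in>J. of_nat k + c j) / (x + of_nat k))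
         = fact n * (\<Prod>j\<in>J. c j - x) / pochhammer x (Suc n)"
  using assms(1,2)
proof (induction J rule: finite_induct)
  case empty
  then show ?case
    using alternating_binomial_reciprocals[OF x] by simp
next
  case (insert i J)
  let ?P = "\<lambda>k. \<Prod>j\<in>J. of_nat k + c j"
  let ?a = "\<lambda>k. (-1) ^ k * of_nat (n choose k) :: 'a"
  have card: "card J < n"
    using insert by simp
  have "(\<Sum>k\<le>n. ?a k * (\<Prod>j\<in>insert i J. of_nat k + c j) / (x + of_nat k))
      = (\<Sum>k\<le>n. ?a k * ?P k + (c i - x) * (?a k * ?P k / (x + of_nat k)))"
  proof (rule sum.cong)
    fix k assume "k \<in> {..n}"
    then have nz: "x + of_nat k \<noteq> 0"
      using x by simp
    have split: "a * ((of_nat k + c i) * b) / (x + of_nat k)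
        = a * b + (c i - x) * (a * b / (x + of_nat k))" for a b
      using nz by (simp add: divide_simps) (simp add: algebra_simps)
    show "?a k * (\<Prod>j\<in>insert i J. of_nat k + c j) / (x + of_nat k)
        = ?a k * ?P k + (c i - x) * (?a k * ?P k / (x + of_nat k))"
      using insert.hyps by (simp only: prod.insert split not_False_eq_True)
  qed simp
  also have "\<dots> = (\<Sum>k\<le>n. ?a k * ?P k) + (c i - x) * (\<Sum>k\<le>n. ?a k * ?P k / (x + of_nat k))"
    by (simp add: sum.distrib sum_distrib_left)
  also have "\<dots> = (c i - x) * (fact n * (\<Prod>j\<in>J. c j - x) / pochhammer x (Suc n))"
    using alternating_binomial_sum_prod_eq_0[OF insert.hyps(1) card, of c] insert.IH card by simp
  finally show ?case
    using insert.hyps by (simp add: mult_ac)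
qed

lemma prod_shifted_eq_fact_quotient:
  "(\<Prod>j=1..q. of_nat k + of_nat j) = (fact (k + q) / fact k :: 'a::field_char_0)"
proof (induction q)
  case 0
  then show ?case by simp
next
  case (Suc q)
  have "(\<Prod>j=1..Suc q. of_nat k + of_nat j)
      = (\<Prod>j=1..q. of_nat k + of_nat j) * (of_nat (Suc (k + q)) :: 'a)"
    by (simp add: add_ac)
  also have "\<dots> = fact (k + Suc q) / fact k"
    unfolding Suc.IH by simp
  finally show ?case .
qed

lemma binomial_product_eq_fact_quotient:
  fixes n k :: nat
  assumes "k \<le> n" and "n \<ge> 1"
  shows "real ((n + k) choose (2 * k)) * real ((2 * k) choose k) / real (n + k)
         = real (n choose k) * (\<Prod>j=1..n-1. real k + real j) / fact n"
proof -
  have outer: "real ((n + k) choose (2 * k)) = fact (n + k) / (fact (2 * k) * fact (n - k))"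
    using assms by (simp add: binomial_fact)
  have inner: "real ((2 * k) choose k) = fact (2 * k) / (fact k * fact k)"
    by (simp add: binomial_fact)
  have right: "real (n choose k) = fact n / (fact k * fact (n - k))"
    using assms by (simp add: binomial_fact)
  have reduce: "fact (n + k) / real (n + k) = fact (k + (n - 1))"
    using assms fact_reduce[of "n + k", where 'a=real] by (simp add: add.commute del: of_nat_add)
  have "real ((n + k) choose (2 * k)) * real ((2 * k) choose k) / real (n + k)
      = (fact (n + k) / real (n + k)) / (fact (n - k) * (fact k * fact k))"
    unfolding outer inner by simp
  also have "\<dots> = real (n choose k) * (fact (k + (n - 1)) / fact k) / fact n"
    unfolding reduce right by simp
  finally show ?thesis
    unfolding prod_shifted_eq_fact_quotient .
qed

text \<open>
  The \<open>m\<close> numbers below \<open>m + 1\<close> contribute \<open>(-1)^m * m!\<close>, the \<open>r\<close> numbers above it contribute \<open>r!\<close>.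
\<close>

lemma prod_differences_from_node:
  "(\<Prod>j\<in>{1..m + r + 1} - {m + 1}. real j - real (m + 1)) = (-1) ^ m * fact m * fact r"
proof (induction r)
  case 0
  have "{1..m + 1} - {m + 1} = {1..m}"
    by auto
  moreover have "(\<Prod>j=1..m. real j - real (m + 1)) = (\<Prod>j=1..m. - real j)"
    by (rule prod.reindex_bij_witness[of _ "\<lambda>j. m + 1 - j" "\<lambda>j. m + 1 - j"]) auto
  moreover have "\<dots> = (-1) ^ m * fact m"
    by (simp add: prod_uminus fact_prod)
  ultimately show ?case
    by simp
next
  case (Suc r)
  have "{1..m + Suc r + 1} - {m + 1} = insert (m + Suc r + 1) ({1..m + r + 1} - {m + 1})"
    by auto
  then show ?case
    using Suc by simp
qed

theorem theorem3p7:
  fixes n m :: nat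
  assumes "n \<ge> 1" and "m < n - 1"
  shows "(\<Sum>k=0..n. real ((n + k) choose (2 * k)) * real ((2 * k) choose k) *
            ((-1) ^ k / (real (n + k) * (real (m + k + 1))\<^sup>2)))
         = (-1) ^ m * (fact m)\<^sup>2 * fact (n - m - 2) / fact (n + m + 1)"
proof -
  define x where "x = real (m + 1)"
  define J where "J = {1..n-1} - {m + 1}"
  have node: "m + 1 \<in> {1..n-1}"
    using assms by simp
  have J: "finite J" "card J \<le> n"
    using card_Diff1_le[of "{1..n-1}" "m + 1"] by (auto simp: J_def)
  \<comment> \<open>The factor of \<open>Q k\<close> with index \<open>m + 1\<close> cancels one of the two factors \<open>m + k + 1\<close>.\<close>
  have summand: "real ((n + k) choose (2 * k)) * real ((2 * k) choose k) *
        ((-1) ^ k / (real (n + k) * (real (m + k + 1))\<^sup>2))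
      = ((-1) ^ k * real (n choose k) * (\<Prod>j\<in>J. real k + real j) / (x + real k)) / fact n"
    if "k \<le> n" for k
  proof -
    have mk: "real (m + k + 1) = x + real k" and nz: "x + real k \<noteq> 0"
      by (simp_all add: x_def)
    have "(\<Prod>j=1..n-1. real k + real j) = (x + real k) * (\<Prod>j\<in>J. real k + real j)"
      using prod.remove[OF _ node, of "\<lambda>j. real k + real j"] by (simp add: J_def x_def add_ac)
    with binomial_product_eq_fact_quotient[OF that assms(1)]
    have coeff: "real ((n + k) choose (2 * k)) * real ((2 * k) choose k) / real (n + k)
        = real (n choose k) * ((x + real k) * (\<Prod>j\<in>J. real k + real j)) / fact n"
      by simp
    have "real ((n + k) choose (2 * k)) * real ((2 * k) choose k) *
        ((-1) ^ k / (real (n + k) * (real (m + k + 1))\<^sup>2))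
      = real ((n + k) choose (2 * k)) * real ((2 * k) choose k) / real (n + k)
        * ((-1) ^ k / (x + real k)\<^sup>2)"
      unfolding mk by simp
    then show ?thesis
      unfolding coeff using nz by (simp add: power2_eq_square mult_ac)
  qed
  have "(\<Sum>k=0..n. real ((n + k) choose (2 * k)) * real ((2 * k) choose k) *
            ((-1) ^ k / (real (n + k) * (real (m + k + 1))\<^sup>2)))
      = (\<Sum>k\<le>n. (-1) ^ k * real (n choose k) * (\<Prod>j\<in>J. real k + real j) / (x + real k)) / fact n"
    unfolding sum_divide_distrib atLeast0AtMost by (intro sum.cong) (simp_all only: summand atMost_iff)
  also have "\<dots> = (\<Prod>j\<in>J. real j - x) / pochhammer x (Suc n)"
    using alternating_binomial_partial_fractions[OF J, of x real] by (simp add: x_def)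
  also have "(\<Prod>j\<in>J. real j - x) = (-1) ^ m * fact m * fact (n - m - 2)"
  proof -
    have "n - 1 = m + (n - m - 2) + 1"
      using assms by simp
    then show ?thesis
      using prod_differences_from_node[of m "n - m - 2"] by (simp add: J_def x_def)
  qed
  also have "pochhammer x (Suc n) = fact (n + m + 1) / fact m"
  proof -
    have "pochhammer x (Suc n) = (\<Prod>j=1..Suc n. real m + real j)"
      unfolding x_def pochhammer_prod atLeast0LessThan
      by (rule prod.reindex_bij_witness[of _ "\<lambda>j. j - 1" Suc]) auto
    then show ?thesis
      unfolding prod_shifted_eq_fact_quotient by (simp add: add_ac)
  qed
  finally show ?thesis
    by (simp add: power2_eq_square)
qed

end
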